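(* Let $X$ and $\Lambda$ be (nonempty) compact metric spaces, let $w:\Lambda\times X\to X$ be a weakly hyperbolic iterated function system, and let $p$ be a Borel probability measure on $\Lambda$. Then $w$ has a measure-theoretical attractor $\nu\in\mathcal M(X)$, that is, $T_p^n(\mu)\to\nu$ in the Hutchinson metric for all $\mu\in\mathcal M(X)$, and $\nu$ is the unique fixed point of the transfer operator $T_p$. Furthermore, if $p(U)>0$ for every nonempty open set $U\subset\Lambda$, then $\mathrm{supp}(\nu)=K$, where $K$ is the global topological attractor of $w$.
   Context: An iterated function system (IFS) is a continuous map $w:\Lambda\times X\to X$; put $w_\lambda(x):=w(\lambda,x)$ and $w_{\lambda_1\dots\lambda_n}:=w_{\lambda_1}\circ\cdots\circ w_{\lambda_n}$. $\Omega:=\Lambda^{\mathbb N}$ is the space of infinite words $\sigma=(\sigma_1,\sigma_2,\dots)$. With $X$ compact, $w$ is weakly hyperbolic if for every $\sigma\in\Omega$, $\lim_{n\to\infty}\mathrm{Diam}(w_{\sigma_1\dots\sigma_n}(X))=0$. $\mathcal K(X)$ is the family of nonempty compact subsets of $X$ with the Hausdorff metric, and $\mathcal F:\mathcal K(X)\to\mathcal K(X)$ is $\mathcal F(A)=\bigcup_{\lambda\in\Lambda}w_\lambda(A)$. The global topological attractor of $w$ is the set $K\in\mathcal K(X)$ such that $\mathcal F^n(B)\to K$ in the Hausdorff metric for every $B\in\mathcal K(X)$ (it exists and is unique for a weakly hyperbolic IFS on compact $X$). $\mathcal M(X)$ is the set of Borel probability measures $\mu$ on $X$ such that $\int_X f\,d\mu<+\infty$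 for all $f\in\mathrm{Lip}_1(X;\mathbb R)=\{f:X\to\mathbb R:|f(x)-f(y)|\le d(x,y)\ \forall x,y\}$ (for compact $X$, all Borel probability measures). The Hutchinson metric is $H(\nu,\mu)=\sup\{|\int f\,d\nu-\int f\,d\mu|: f\in\mathrm{Lip}_1(X;\mathbb R)\}$. The transfer operator $T_p:\mathcal M(X)\to\mathcal M(X)$ is $T_p(\mu)(B)=\int_\Lambda\mu(w_\lambda^{-1}(B))\,dp(\lambda)$ for Borel $B\subset X$. *)

theory Defs
  imports "HOL-Probability.Probability"
begin

section \<open>Iterated function systems\<close>

definition ifs :: "('l::topological_space \<Rightarrow> 'x::topological_space \<Rightarrow> 'x) \<Rightarrow> bool" where
  "ifs w \<longleftrightarrow> continuous_on UNIV (\<lambda>(l, x). w l x)"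

text \<open>Words are sequences indexed from 0, so that \<open>\<sigma> i\<close> is the letter \<open>\<sigma>\<^sub>i\<^sub>+\<^sub>1\<close>; thus
  \<open>word_map w \<sigma> n = w (\<sigma> 0) \<circ> \<dots> \<circ> w (\<sigma> (n - 1))\<close>, the last letter being applied first.\<close>

primrec word_map :: "('l \<Rightarrow> 'x \<Rightarrow> 'x) \<Rightarrow> (nat \<Rightarrow> 'l) \<Rightarrow> nat \<Rightarrow> 'x \<Rightarrow> 'x" where
  "word_map w \<sigma> 0 = id"
| "word_map w \<sigma> (Suc n) = word_map w \<sigma> n \<circ> w (\<sigma> n)"

definition weakly_hyperbolic :: "('l \<Rightarrow> 'x::metric_space \<Rightarrow> 'x) \<Rightarrow> bool" where
  "weakly_hyperbolic w \<longleftrightarrow> (\<forall>\<sigma>. (\<lambda>n. diameter (range (word_map w \<sigma> n))) \<longlonglongrightarrow> 0)"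


section \<open>The global topological attractor\<close>

definition hausdorff_dist :: "'x::metric_space set \<Rightarrow> 'x set \<Rightarrow> real" where
  "hausdorff_dist A B = max (SUP a\<in>A. infdist a B) (SUP b\<in>B. infdist b A)"

definition hutchinson_op :: "('l \<Rightarrow> 'x \<Rightarrow> 'x) \<Rightarrow> 'x set \<Rightarrow> 'x set" where
  "hutchinson_op w A = (\<Union>l. w l ` A)"

definition topological_attractor :: "('l \<Rightarrow> 'x::metric_space \<Rightarrow> 'x) \<Rightarrow> 'x set \<Rightarrow> bool" where
  "topological_attractor w K \<longleftrightarrow> compact K \<and> K \<noteq> {} \<and>
     (\<forall>B. compact B \<and> B \<noteq> {} \<longrightarrow> (\<lambda>n. hausdorff_dist ((hutchinson_op w ^^ n) B) K) \<longlonglongrightarrow> 0)"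

lemma infdist_le_hausdorff_dist:
  fixes A B :: "'x::metric_space set"
  assumes "bounded (UNIV :: 'x set)" "a \<in> A" "B \<noteq> {}"
  shows "infdist a B \<le> hausdorff_dist A B" "infdist a B \<le> hausdorff_dist B A"
proof -
  obtain b where b: "b \<in> B" using assms by blast
  have bd: "infdist x B \<le> diameter (UNIV :: 'x set)" for x
    using infdist_le[OF b, of x] diameter_bounded_bound[OF assms(1), of x b] by simp
  have "infdist a B \<le> (SUP a\<in>A. infdist a B)"
    by (rule cSUP_upper[OF assms(2)]) (use bd in \<open>auto intro!: bdd_aboveI2\<close>)
  then show "infdist a B \<le> hausdorff_dist A B" "infdist a B \<le> hausdorff_dist B A"
    by (auto simp: hausdorff_dist_def)
qed

lemma hutchinson_op_pow_nonempty: "B \<noteq> {} \<Longrightarrow> (hutchinson_op w ^^ n) B \<noteq> {}"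
  by (induction n) (auto simp: hutchinson_op_def)

lemma topological_attractor_unique:
  fixes w :: "'l \<Rightarrow> 'x::metric_space \<Rightarrow> 'x"
  assumes "compact (UNIV :: 'x set)" "topological_attractor w K" "topological_attractor w L"
  shows "K = L"
proof -
  have *: "K \<subseteq> L" if K: "topological_attractor w K" and L: "topological_attractor w L" for K L
  proof
    fix x assume x: "x \<in> K"
    have bdd: "bounded (UNIV :: 'x set)" using assms(1) by (rule compact_imp_bounded)
    have L': "closed L" "L \<noteq> {}"
      using L by (auto simp: topological_attractor_def compact_imp_closed)
    define A where "A n = (hutchinson_op w ^^ n) K" for n
    have A: "A n \<noteq> {}" for n unfolding A_def using x by (intro hutchinson_op_pow_nonempty) auto
    have "infdist x L \<le> hausdorff_dist (A n) K + hausdorff_dist (A n) L" for n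
    proof -
      have "infdist x L - hausdorff_dist (A n) L \<le> dist x a" if a: "a \<in> A n" for a
        using infdist_triangle[of x L a] infdist_le_hausdorff_dist(1)[OF bdd a L'(2)] by simp
      then have "infdist x L - hausdorff_dist (A n) L \<le> infdist x (A n)"
        using A by (simp add: infdist_notempty cINF_greatest)
      also have "\<dots> \<le> hausdorff_dist (A n) K"
        by (rule infdist_le_hausdorff_dist(2)[OF bdd x A])
      finally show ?thesis by simp
    qed
    moreover have "(\<lambda>n. hausdorff_dist (A n) K + hausdorff_dist (A n) L) \<longlonglongrightarrow> 0 + 0"
      using K L unfolding A_def by (intro tendsto_add) (auto simp: topological_attractor_def)
    ultimately have "infdist x L \<le> 0 + 0"
      by (intro LIMSEQ_le_const) auto
    then have "infdist x L = 0" using infdist_nonneg[of x L] by simp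
    then show "x \<in> L" using L' by (simp add: in_closed_iff_infdist_zero)
  qed
  show ?thesis using *[OF assms(2,3)] *[OF assms(3,2)] by blast
qed


section \<open>The Hutchinson metric\<close>

definition Lip1 :: "('x::metric_space \<Rightarrow> real) set" where
  "Lip1 = {f. 1-lipschitz_on UNIV f}"

text \<open>Since \<open>Lip1\<close> is closed under \<open>f \<mapsto> \<bar>f\<bar>\<close>, finiteness of \<open>\<integral> f d\<mu>\<close> for all \<open>f \<in> Lip1\<close>
  is integrability of all \<open>f \<in> Lip1\<close>.\<close>

definition lip_prob_measures :: "'x::metric_space measure set" where
  "lip_prob_measures =
     {\<mu>. sets \<mu> = sets borel \<and> prob_space \<mu> \<and> (\<forall>f\<in>Lip1. integrable \<mu> f)}"

text \<open>A real supremum: for \<open>\<mu>, \<nu> \<in> lip_prob_measures\<close> the values are bounded by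
  \<open>\<integral> d(x, x\<^sub>0) d\<nu>(x) + \<integral> d(x, x\<^sub>0) d\<mu>(x)\<close>.\<close>

definition hutchinson_dist :: "'x::metric_space measure \<Rightarrow> 'x measure \<Rightarrow> real" where
  "hutchinson_dist \<nu> \<mu> = (SUP f\<in>Lip1. \<bar>(\<integral>x. f x \<partial>\<nu>) - (\<integral>x. f x \<partial>\<mu>)\<bar>)"


section \<open>The transfer operator\<close>

definition transfer_op ::
    "('l \<Rightarrow> 'x::topological_space \<Rightarrow> 'x) \<Rightarrow> 'l measure \<Rightarrow> 'x measure \<Rightarrow> 'x measure" where
  "transfer_op w p \<mu> = measure_of UNIV (sets borel) (\<lambda>B. \<integral>\<^sup>+ l. emeasure \<mu> (w l -` B) \<partial>p)"

text \<open>The set function in \<open>transfer_op\<close> is indeed a measure, so that \<open>measure_of\<close> does not fall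
  back to the null measure. The type \<open>'x\<close> is not in class \<open>second_countable_topology\<close>, so
  measurability of \<open>w\<close> is derived from compactness.\<close>

lemma compact_countable_basis:
  assumes "compact (UNIV :: 'a::metric_space set)"
  obtains \<B> :: "'a::metric_space set set" where "countable \<B>" "\<And>b. b \<in> \<B> \<Longrightarrow> open b"
    "\<And>U x. open U \<Longrightarrow> x \<in> U \<Longrightarrow> \<exists>b\<in>\<B>. x \<in> b \<and> b \<subseteq> U"
proof -
  have "\<exists>k. finite k \<and> UNIV \<subseteq> (\<Union>x\<in>k. ball (x::'a) (1 / Suc n))" for n
    using compact_eq_totally_bounded[of "UNIV :: 'a set"] assms by auto
  then obtain k where k: "\<And>n. finite (k n)" "\<And>n. UNIV \<subseteq> (\<Union>x\<in>k n. ball (x::'a) (1 / Suc n))"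
    by metis
  define \<B> where "\<B> = (\<Union>n. (\<lambda>x. ball x (1 / Suc n)) ` k n)"
  show thesis
  proof (rule that[of \<B>])
    show "countable \<B>" unfolding \<B>_def
      using k(1) by (auto intro: countable_finite)
    show "open b" if "b \<in> \<B>" for b using that by (auto simp: \<B>_def)
    fix U and x :: 'a assume U: "open U" "x \<in> U"
    then obtain e where e: "e > 0" "ball x e \<subseteq> U" by (auto simp: open_contains_ball)
    obtain n where n: "1 / real (Suc n) < e / 2"
      using e(1) nat_approx_posE[of "e / 2"] by auto
    obtain y where y: "y \<in> k n" "x \<in> ball y (1 / Suc n)" using k(2)[of n] by blast
    have "ball y (1 / Suc n) \<subseteq> ball x e"
    proof
      fix z assume "z \<in> ball y (1 / Suc n)"
      then show "z \<in> ball x e"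
        using y(2) n dist_triangle[of x z y] by (simp add: dist_commute)
    qed
    then show "\<exists>b\<in>\<B>. x \<in> b \<and> b \<subseteq> U" using y e unfolding \<B>_def by blast
  qed
qed

lemma ifs_measurable:
  fixes w :: "'l::metric_space \<Rightarrow> 'x::metric_space \<Rightarrow> 'x"
  assumes "compact (UNIV :: 'l set)" "compact (UNIV :: 'x set)" "ifs w"
  shows "case_prod w \<in> borel_measurable (borel \<Otimes>\<^sub>M borel)"
proof (rule borel_measurableI)
  fix S :: "'x set" assume "open S"
  then have U: "open (case_prod w -` S)"
    using assms(3) by (simp add: ifs_def open_vimage)
  obtain \<B> :: "'l set set" where B: "countable \<B>" "\<And>b. b \<in> \<B> \<Longrightarrow> open b"
    "\<And>U x. open U \<Longrightarrow> x \<in> U \<Longrightarrow> \<exists>b\<in>\<B>. x \<in> b \<and> b \<subseteq> U"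
    using compact_countable_basis[OF assms(1)] by metis
  obtain \<C> :: "'x set set" where C: "countable \<C>" "\<And>b. b \<in> \<C> \<Longrightarrow> open b"
    "\<And>U x. open U \<Longrightarrow> x \<in> U \<Longrightarrow> \<exists>b\<in>\<C>. x \<in> b \<and> b \<subseteq> U"
    using compact_countable_basis[OF assms(2)] by metis
  let ?U = "case_prod w -` S"
  define \<R> where "\<R> = {(b, c) \<in> \<B> \<times> \<C>. b \<times> c \<subseteq> ?U}"
  have "countable \<R>"
    using B(1) C(1) by (auto simp: \<R>_def intro: countable_subset[of _ "\<B> \<times> \<C>"])
  moreover have "?U = (\<Union>(b, c)\<in>\<R>. b \<times> c)"
  proof
    show "(\<Union>(b, c)\<in>\<R>. b \<times> c) \<subseteq> ?U" by (auto simp: \<R>_def)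
    show "?U \<subseteq> (\<Union>(b, c)\<in>\<R>. b \<times> c)"
    proof (rule subsetI)
      fix z assume "z \<in> ?U"
      then obtain G H where GH: "open G" "open H" "z \<in> G \<times> H" "G \<times> H \<subseteq> ?U"
        using open_prod_elim[OF U] by metis
      obtain b where b: "b \<in> \<B>" "fst z \<in> b" "b \<subseteq> G" using B(3)[OF GH(1), of "fst z"] GH(3) by auto
      obtain c where c: "c \<in> \<C>" "snd z \<in> c" "c \<subseteq> H" using C(3)[OF GH(2), of "snd z"] GH(3) by auto
      have "b \<times> c \<subseteq> ?U" using GH(4) b(3) c(3) by blast
      then have "(b, c) \<in> \<R>" using b(1) c(1) by (simp add: \<R>_def)
      moreover have "z \<in> b \<times> c" using b(2) c(2) by (simp add: mem_Times_iff)
      ultimately show "z \<in> (\<Union>(b, c)\<in>\<R>. b \<times> c)" by blast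
    qed
  qed
  moreover have "b \<times> c \<in> sets (borel \<Otimes>\<^sub>M borel)" if "(b, c) \<in> \<R>" for b c
    using that B(2) C(2) by (auto simp: \<R>_def)
  ultimately have "?U \<in> sets (borel \<Otimes>\<^sub>M borel)"
    by (auto intro!: sets.countable_UN')
  then show "case_prod w -` S \<inter> space (borel \<Otimes>\<^sub>M borel) \<in> sets (borel \<Otimes>\<^sub>M borel)"
    by (simp add: space_pair_measure)
qed

lemma emeasure_transfer_op:
  fixes w :: "'l::metric_space \<Rightarrow> 'x::metric_space \<Rightarrow> 'x"
  assumes "compact (UNIV :: 'l set)" "compact (UNIV :: 'x set)" "ifs w"
    and "prob_space p" "sets p = sets borel" "prob_space \<mu>" "sets \<mu> = sets borel"
    and B: "B \<in> sets borel"
  shows "emeasure (transfer_op w p \<mu>) B = (\<integral>\<^sup>+ l. emeasure \<mu> (w l -` B) \<partial>p)"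
proof -
  interpret p: prob_space p by fact
  interpret \<mu>: prob_space \<mu> by fact
  have sp: "space p = UNIV" "space \<mu> = UNIV"
    using sets_eq_imp_space_eq[OF assms(5)] sets_eq_imp_space_eq[OF assms(7)] by auto
  have sets: "sets (p \<Otimes>\<^sub>M \<mu>) = sets (borel \<Otimes>\<^sub>M borel)"
    by (rule sets_pair_measure_cong) fact+
  have m: "case_prod w \<in> p \<Otimes>\<^sub>M \<mu> \<rightarrow>\<^sub>M borel"
    using ifs_measurable[OF assms(1-3)] by (subst measurable_cong_sets[OF sets refl])
  define D where "D = distr (p \<Otimes>\<^sub>M \<mu>) borel (case_prod w)"
  have D: "emeasure D A = (\<integral>\<^sup>+ l. emeasure \<mu> (w l -` A) \<partial>p)" if "A \<in> sets borel" for A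
  proof -
    have "case_prod w -` A \<in> sets (p \<Otimes>\<^sub>M \<mu>)"
      using measurable_sets[OF m that] by (simp add: space_pair_measure sp)
    then show ?thesis using m that
      by (simp add: D_def emeasure_distr space_pair_measure sp \<mu>.emeasure_pair_measure_alt vimage_def)
  qed
  have "transfer_op w p \<mu> = measure_of UNIV (sets borel) (emeasure D)"
    unfolding transfer_op_def
    by (rule measure_of_eq) (auto simp: D sets.sigma_sets_eq[of borel, simplified])
  also have "\<dots> = D"
    using measure_of_of_measure[of D] by (simp add: D_def)
  finally show ?thesis using D[OF B] by simp
qed


section \<open>The measure-theoretical attractor and supports\<close>

definition measure_attractor ::
    "('l \<Rightarrow> 'x::metric_space \<Rightarrow> 'x) \<Rightarrow> 'l measure \<Rightarrow> 'x measure \<Rightarrow> bool" where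
  "measure_attractor w p \<nu> \<longleftrightarrow> \<nu> \<in> lip_prob_measures \<and>
     (\<forall>\<mu>\<in>lip_prob_measures. (\<lambda>n. hutchinson_dist ((transfer_op w p ^^ n) \<mu>) \<nu>) \<longlonglongrightarrow> 0)"

definition measure_support :: "'x::topological_space measure \<Rightarrow> 'x set" where
  "measure_support \<nu> = {x. \<forall>U. open U \<and> x \<in> U \<longrightarrow> measure \<nu> U > 0}"

end

theory Submission
  imports Defs
begin

text \<open>
  Everything about the system is read off from a space of random words. Weak hyperbolicity is a
  statement about each infinite word separately, but the words whose first \<open>n\<close> letters leave
  two image points at distance at least \<open>\<epsilon>\<close> form a closed set that decreases with \<open>n\<close>; as the space
  of words is compact, the contraction is uniform in the word (\<open>uniform_contraction\<close>). Hence
  \<open>word_map w \<sigma> n x\<close> converges, uniformly in \<open>\<sigma>\<close> and \<open>x\<close>, to a point \<open>coding_map \<sigma>\<close>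
  that does not depend on \<open>x\<close>, and the coding map is continuous.

  The topological attractor is the range of the coding map, since \<open>n\<close> applications of the
  Hutchinson operator to \<open>B\<close> give the union of the sets \<open>word_map w \<sigma> n ` B\<close>.

  The invariant measure is the law of \<open>coding_map \<sigma>\<close> when the letters of \<open>\<sigma>\<close> are chosen
  independently with law \<open>p\<close>. Likewise \<open>n\<close> applications of the transfer operator to \<open>\<mu>\<close> give the
  law of \<open>word_map w \<sigma> n x\<close> with \<open>\<sigma>\<close> as before and \<open>x\<close> of law \<open>\<mu>\<close>, independent of \<open>\<sigma>\<close>
  (\<open>transfer_op_pow\<close>). These two random points are defined on the same probability space and are
  uniformly close for large \<open>n\<close>, so the integrals of all 1-Lipschitz functions are uniformly close
  (\<open>uniform_integral_convergence\<close>), which is convergence in the Hutchinson metric. A fixed point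
  has the same Lipschitz integrals as the limit, and these determine a Borel probability measure.

  If \<open>p\<close> charges every nonempty open set, then so does the product measure on words;
  pulling back along the continuous coding map shows that the support of the invariant
  measure is the whole range.
\<close>

section \<open>Words and the coding map\<close>

text \<open>Prepending a letter to a word composes with the new map on the outside. The transfer and
  Hutchinson operators act on the outside as well, while the recursion of \<open>word_map\<close> appends
  letters on the inside; this identity links the two directions.\<close>

lemma word_map_case_nat:
  "word_map w (case_nat l \<sigma>) (Suc n) = w l \<circ> word_map w \<sigma> n"
  by (induction n) (auto simp: fun_eq_iff)

lemma range_word_map_antimono:
  assumes "m \<le> n"
  shows "range (word_map w \<sigma> n) \<subseteq> range (word_map w \<sigma> m)"
  using assms by (induction rule: dec_induct) auto

lemma UN_case_nat:
  fixes F :: "(nat \<Rightarrow> 'b) \<Rightarrow> 'a set"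
  shows "(\<Union>\<sigma>. F \<sigma>) = (\<Union>l. \<Union>\<tau>. F (case_nat l \<tau>))"
proof (intro equalityI UN_least UN_upper UNIV_I)
  fix \<sigma> :: "nat \<Rightarrow> 'b"
  have "case_nat (\<sigma> 0) (\<lambda>i. \<sigma> (Suc i)) = \<sigma>"
    by (auto split: nat.split)
  then have "F \<sigma> = F (case_nat (\<sigma> 0) (\<lambda>i. \<sigma> (Suc i)))" by simp
  also have "\<dots> \<subseteq> (\<Union>l. \<Union>\<tau>. F (case_nat l \<tau>))" by blast
  finally show "F \<sigma> \<subseteq> (\<Union>l. \<Union>\<tau>. F (case_nat l \<tau>))" .
qed

lemma hutchinson_op_pow:
  "(hutchinson_op w ^^ n) B = (\<Union>\<sigma>. word_map w \<sigma> n ` B)"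
proof (induction n)
  case 0
  show ?case by simp
next
  case (Suc n)
  have "(\<Union>\<sigma>. word_map w \<sigma> (Suc n) ` B) = (\<Union>l. \<Union>\<tau>. word_map w (case_nat l \<tau>) (Suc n) ` B)"
    by (rule UN_case_nat)
  also have "\<dots> = hutchinson_op w (\<Union>\<sigma>. word_map w \<sigma> n ` B)"
    unfolding word_map_case_nat hutchinson_op_def by auto
  finally show ?case using Suc.IH by simp
qed

lemma compact_UNIV_fun:
  assumes "compact (UNIV :: 'b::topological_space set)"
  shows "compact (UNIV :: ('a \<Rightarrow> 'b) set)"
proof -
  have "compact_space (product_topology (\<lambda>_::'a. euclidean :: 'b topology) UNIV)"
    using assms unfolding compact_space_product_topology by (simp add: compact_space_def)
  then show ?thesis
    by (simp add: euclidean_product_topology compact_space_def)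
qed

lemma continuous_on_word_map:
  fixes w :: "'l::topological_space \<Rightarrow> 'x::topological_space \<Rightarrow> 'x"
  assumes "ifs w"
  shows "continuous_on UNIV (\<lambda>(\<sigma>, x). word_map w \<sigma> n x)"
proof (induction n)
  case 0
  show ?case by (simp add: case_prod_beta continuous_on_snd continuous_on_id)
next
  case (Suc n)
  have w: "continuous_on UNIV (\<lambda>z. w (fst z) (snd z))"
    using assms by (simp add: ifs_def case_prod_beta)
  have coord: "continuous_on UNIV (\<lambda>z::(nat \<Rightarrow> 'l) \<times> 'x. fst z n)"
    by (rule continuous_on_product_then_coordinatewise) (intro continuous_intros)
  have "continuous_on UNIV (\<lambda>z::(nat \<Rightarrow> 'l) \<times> 'x. w (fst z n) (snd z))"
    using continuous_on_compose2[OF w continuous_on_Pair[OF coord continuous_on_snd[OF continuous_on_id]]]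
    by simp
  then have "continuous_on UNIV (\<lambda>z::(nat \<Rightarrow> 'l) \<times> 'x. (fst z, w (fst z n) (snd z)))"
    by (intro continuous_on_Pair continuous_on_fst continuous_on_id)
  from continuous_on_compose2[OF Suc.IH this] show ?case
    by (simp add: case_prod_beta)
qed

locale weakly_hyperbolic_ifs =
  fixes w :: "'l::metric_space \<Rightarrow> 'x::metric_space \<Rightarrow> 'x"
  assumes compact_params: "compact (UNIV :: 'l set)"
    and compact_space: "compact (UNIV :: 'x set)"
    and ifs: "ifs w"
    and weakly_hyperbolic: "weakly_hyperbolic w"
begin

lemma bounded_space: "bounded (A :: 'x set)"
  using compact_imp_bounded[OF compact_space] bounded_subset by blast

text \<open>A compactness argument in the style of Dini's theorem. For \<open>\<epsilon> > 0\<close> the words \<open>\<sigma>\<close> whose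
  image \<open>range (word_map w \<sigma> n)\<close> still contains two points at distance at least \<open>\<epsilon>\<close> form a
  decreasing sequence of closed subsets of the compact space of words. Weak hyperbolicity says
  that its intersection is empty, so some member is already empty.\<close>
lemma uniform_contraction:
  assumes "0 < \<epsilon>"
  obtains N where "\<And>\<sigma> n x y. N \<le> n \<Longrightarrow> dist (word_map w \<sigma> n x) (word_map w \<sigma> n y) < \<epsilon>"
proof -
  define C where "C n = {\<sigma>. \<exists>x y. \<epsilon> \<le> dist (word_map w \<sigma> n x) (word_map w \<sigma> n y)}" for n
  \<comment> \<open>\<open>C n\<close> is the projection to the words of a closed set in a compact product.\<close>
  have closed: "closed (C n)" for n
  proof -
    let ?D = "{z::(nat \<Rightarrow> 'l) \<times> 'x \<times> 'x.
      \<epsilon> \<le> dist (word_map w (fst z) n (fst (snd z))) (word_map w (fst z) n (snd (snd z)))}"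
    have W: "continuous_on UNIV (\<lambda>z. word_map w (fst z) n (snd z))"
      using continuous_on_word_map[OF ifs, of n] by (simp add: case_prod_beta)
    have "continuous_on UNIV (\<lambda>z::(nat \<Rightarrow> 'l) \<times> 'x \<times> 'x. (fst z, fst (snd z)))"
      "continuous_on UNIV (\<lambda>z::(nat \<Rightarrow> 'l) \<times> 'x \<times> 'x. (fst z, snd (snd z)))"
      by (intro continuous_on_Pair continuous_on_fst continuous_on_snd continuous_on_id)+
    then have "continuous_on UNIV (\<lambda>z::(nat \<Rightarrow> 'l) \<times> 'x \<times> 'x. word_map w (fst z) n (fst (snd z)))"
      "continuous_on UNIV (\<lambda>z::(nat \<Rightarrow> 'l) \<times> 'x \<times> 'x. word_map w (fst z) n (snd (snd z)))"
      using continuous_on_compose2[OF W] by fastforce+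
    then have "closed ?D"
      by (intro closed_Collect_le continuous_on_const continuous_on_dist)
    moreover have "compact (UNIV :: ((nat \<Rightarrow> 'l) \<times> 'x \<times> 'x) set)"
      using compact_Times[OF compact_UNIV_fun[OF compact_params] compact_Times[OF compact_space compact_space]]
      by simp
    ultimately have "compact ?D"
      using compact_Int_closed by fastforce
    then have "compact (fst ` ?D)"
      by (intro compact_continuous_image continuous_intros)
    moreover have "fst ` ?D = C n"
      by (force simp: C_def image_iff)
    ultimately show ?thesis by (simp add: compact_imp_closed)
  qed
  have anti: "C n \<subseteq> C m" if mn: "m \<le> n" for m n
  proof
    fix \<sigma> assume "\<sigma> \<in> C n"
    then obtain x y where xy: "\<epsilon> \<le> dist (word_map w \<sigma> n x) (word_map w \<sigma> n y)"
      by (auto simp: C_def)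
    obtain x' y' where "word_map w \<sigma> n x = word_map w \<sigma> m x'" "word_map w \<sigma> n y = word_map w \<sigma> m y'"
      using range_word_map_antimono[OF mn, of w \<sigma>] by blast
    with xy show "\<sigma> \<in> C m" by (auto simp: C_def)
  qed
  have "\<exists>N. C N = {}"
  proof (rule ccontr)
    assume "\<not> ?thesis"
    then have ne: "C n \<noteq> {}" for n by blast
    have "UNIV \<inter> (\<Inter>n\<in>UNIV. C n) \<noteq> {}"
    proof (rule compact_imp_fip_image[OF compact_UNIV_fun[OF compact_params] closed])
      fix I :: "nat set" assume "finite I"
      then have "C (Max (insert 0 I)) \<subseteq> (\<Inter>i\<in>I. C i)"
        by (intro INT_greatest anti) auto
      then show "UNIV \<inter> (\<Inter>i\<in>I. C i) \<noteq> {}" using ne by blast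
    qed
    then obtain \<sigma> where \<sigma>: "\<And>n. \<sigma> \<in> C n" by auto
    have "\<epsilon> \<le> diameter (range (word_map w \<sigma> n))" for n
    proof -
      obtain x y where "\<epsilon> \<le> dist (word_map w \<sigma> n x) (word_map w \<sigma> n y)"
        using \<sigma>[of n] by (auto simp: C_def)
      then show ?thesis
        using diameter_bounded_bound[OF bounded_space rangeI rangeI, of "word_map w \<sigma> n" x y] by linarith
    qed
    moreover have "(\<lambda>n. diameter (range (word_map w \<sigma> n))) \<longlonglongrightarrow> 0"
      using weakly_hyperbolic by (simp add: weakly_hyperbolic_def)
    ultimately have "\<epsilon> \<le> 0"
      by (intro LIMSEQ_le_const) auto
    then show False using assms by simp
  qed
  then obtain N where "C N = {}" ..
  then have "C n = {}" if "N \<le> n" for n using anti[OF that] by simp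
  then show thesis
    by (intro that[of N]) (force simp: C_def not_le)
qed

text \<open>The base point \<open>undefined\<close> is an arbitrary point of the space; \<open>coding_map_tendsto\<close> shows
  that every other one gives the same limit.\<close>
definition coding_map :: "(nat \<Rightarrow> 'l) \<Rightarrow> 'x" where
  "coding_map \<sigma> = lim (\<lambda>n. word_map w \<sigma> n undefined)"

text \<open>For \<open>m \<ge> n\<close> the point \<open>word_map w \<sigma> m x\<close> lies in \<open>range (word_map w \<sigma> n)\<close>, which is small
  uniformly in \<open>\<sigma>\<close>. This yields both the Cauchy property, hence the limit, and a rate that
  depends neither on the word nor on the starting point.\<close>
lemma coding_map_uniform:
  assumes "0 < \<epsilon>"
  obtains N where "\<And>\<sigma> n x. N \<le> n \<Longrightarrow> dist (word_map w \<sigma> n x) (coding_map \<sigma>) < \<epsilon>"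
proof -
  have conv: "(\<lambda>n. word_map w \<sigma> n undefined) \<longlonglongrightarrow> coding_map \<sigma>" for \<sigma>
  proof -
    have "Cauchy (\<lambda>n. word_map w \<sigma> n undefined)"
    proof (rule metric_CauchyI)
      fix e :: real assume "0 < e"
      then obtain N where N: "\<And>\<sigma> n x y. N \<le> n \<Longrightarrow> dist (word_map w \<sigma> n x) (word_map w \<sigma> n y) < e"
        by (rule uniform_contraction) blast
      show "\<exists>M. \<forall>m\<ge>M. \<forall>n\<ge>M. dist (word_map w \<sigma> m undefined) (word_map w \<sigma> n undefined) < e"
      proof (intro exI allI impI)
        fix m n assume "N \<le> m" "N \<le> n"
        then obtain x y where
          "word_map w \<sigma> m undefined = word_map w \<sigma> N x" "word_map w \<sigma> n undefined = word_map w \<sigma> N y"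
          using range_word_map_antimono[of N _ w \<sigma>] by blast
        then show "dist (word_map w \<sigma> m undefined) (word_map w \<sigma> n undefined) < e"
          using N[of N \<sigma> x y] by simp
      qed
    qed
    then have "convergent (\<lambda>n. word_map w \<sigma> n undefined)"
      using compact_imp_complete[OF compact_space] by (auto simp: complete_def convergent_def)
    then show ?thesis by (simp add: coding_map_def convergent_LIMSEQ_iff)
  qed
  from half_gt_zero[OF assms] obtain N
    where N: "\<And>\<sigma> n x y. N \<le> n \<Longrightarrow> dist (word_map w \<sigma> n x) (word_map w \<sigma> n y) < \<epsilon> / 2"
    by (rule uniform_contraction) blast
  show thesis
  proof (rule that)
    fix \<sigma> n x assume n: "N \<le> n"
    have "dist (word_map w \<sigma> n x) (word_map w \<sigma> m undefined) \<le> \<epsilon> / 2" if m: "n \<le> m" for m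
    proof -
      obtain y where "word_map w \<sigma> m undefined = word_map w \<sigma> n y"
        using range_word_map_antimono[OF m, of w \<sigma>] by blast
      then show ?thesis using N[OF n, of \<sigma> x y] by simp
    qed
    then have "dist (word_map w \<sigma> n x) (coding_map \<sigma>) \<le> \<epsilon> / 2"
      by (intro LIMSEQ_le_const2[OF tendsto_dist[OF tendsto_const conv]]) auto
    then show "dist (word_map w \<sigma> n x) (coding_map \<sigma>) < \<epsilon>" using assms by simp
  qed
qed

lemma coding_map_tendsto: "(\<lambda>n. word_map w \<sigma> n x) \<longlonglongrightarrow> coding_map \<sigma>"
proof (rule metric_LIMSEQ_I)
  fix e :: real assume "0 < e"
  then obtain N where "\<And>\<sigma> n x. N \<le> n \<Longrightarrow> dist (word_map w \<sigma> n x) (coding_map \<sigma>) < e"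
    by (rule coding_map_uniform) blast
  then show "\<exists>N. \<forall>n\<ge>N. dist (word_map w \<sigma> n x) (coding_map \<sigma>) < e" by blast
qed

text \<open>The coding map intertwines prepending the letter \<open>l\<close> with the map \<open>w l\<close>. This
  self-similarity is what makes the law of the coding map invariant.\<close>
lemma coding_map_case_nat: "coding_map (case_nat l \<sigma>) = w l (coding_map \<sigma>)"
proof -
  have "continuous_on UNIV (\<lambda>x. case (l, x) of (l, x) \<Rightarrow> w l x)"
    by (rule continuous_on_compose2[OF ifs[unfolded ifs_def]
          continuous_on_Pair[OF continuous_on_const continuous_on_id]]) simp
  then have "continuous_on UNIV (w l)" by simp
  then have "(\<lambda>n. w l (word_map w \<sigma> n undefined)) \<longlonglongrightarrow> w l (coding_map \<sigma>)"
    by (rule continuous_on_tendsto_compose[OF _ coding_map_tendsto]) auto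
  moreover have "(\<lambda>n. w l (word_map w \<sigma> n undefined)) \<longlonglongrightarrow> coding_map (case_nat l \<sigma>)"
    using LIMSEQ_Suc[OF coding_map_tendsto[of "case_nat l \<sigma>" undefined]]
    unfolding word_map_case_nat by simp
  ultimately show ?thesis by (rule LIMSEQ_unique[symmetric])
qed

lemma continuous_on_coding_map: "continuous_on UNIV coding_map"
proof (rule uniform_limit_theorem)
  have "continuous_on UNIV (\<lambda>\<sigma>. case (\<sigma>, undefined) of (\<sigma>, x) \<Rightarrow> word_map w \<sigma> n x)" for n
    by (rule continuous_on_compose2[OF continuous_on_word_map[OF ifs]
          continuous_on_Pair[OF continuous_on_id continuous_on_const]]) simp
  then show "\<forall>\<^sub>F n in sequentially. continuous_on UNIV (\<lambda>\<sigma>. word_map w \<sigma> n undefined)"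
    by simp
  show "uniform_limit UNIV (\<lambda>n \<sigma>. word_map w \<sigma> n undefined) coding_map sequentially"
  proof (rule uniform_limitI)
    fix e :: real assume "0 < e"
    then obtain N where "\<And>\<sigma> n x. N \<le> n \<Longrightarrow> dist (word_map w \<sigma> n x) (coding_map \<sigma>) < e"
      by (rule coding_map_uniform) blast
    then show "\<forall>\<^sub>F n in sequentially. \<forall>\<sigma>\<in>UNIV. dist (word_map w \<sigma> n undefined) (coding_map \<sigma>) < e"
      by (auto simp: eventually_sequentially)
  qed
qed simp

section \<open>The topological attractor\<close>

lemma compact_range_coding_map: "compact (range coding_map)"
  by (rule compact_continuous_image[OF continuous_on_coding_map compact_UNIV_fun[OF compact_params]])

text \<open>The points \<open>word_map w \<sigma> n b\<close> with \<open>b \<in> B\<close> exhaust the \<open>n\<close>-th iterate of \<open>B\<close>, and each is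
  uniformly close to the point of the range coded by the same word \<open>\<sigma>\<close>. Read in both directions,
  this bounds both halves of the Hausdorff distance.\<close>
lemma topological_attractor_range_coding_map: "topological_attractor w (range coding_map)"
  unfolding topological_attractor_def
proof (intro conjI allI impI compact_range_coding_map)
  fix B :: "'x set" assume B: "compact B \<and> B \<noteq> {}"
  then obtain b where b: "b \<in> B" by auto
  let ?K = "range coding_map"
  let ?A = "\<lambda>n. (hutchinson_op w ^^ n) B"
  have ne: "?A n \<noteq> {}" for n
    using B by (intro hutchinson_op_pow_nonempty) auto
  have nonneg: "0 \<le> hausdorff_dist (?A n) ?K" for n
  proof -
    obtain a where "a \<in> ?A n" using ne by blast
    from infdist_le_hausdorff_dist(1)[OF bounded_space this, of ?K]
    show ?thesis using infdist_nonneg[of a ?K] by simp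
  qed
  show "(\<lambda>n. hausdorff_dist (?A n) ?K) \<longlonglongrightarrow> 0"
  proof (rule LIMSEQ_I)
    fix r :: real assume "0 < r"
    from half_gt_zero[OF this] obtain N where N: "\<And>\<sigma> n x. N \<le> n \<Longrightarrow> dist (word_map w \<sigma> n x) (coding_map \<sigma>) < r / 2"
      by (rule coding_map_uniform) blast
    have "hausdorff_dist (?A n) ?K \<le> r / 2" if n: "N \<le> n" for n
      unfolding hausdorff_dist_def
    proof (intro max.boundedI cSUP_least ne)
      fix a assume "a \<in> ?A n"
      then obtain \<sigma> x where "a = word_map w \<sigma> n x" by (auto simp: hutchinson_op_pow)
      then show "infdist a ?K \<le> r / 2"
        using infdist_le[of "coding_map \<sigma>" ?K a] N[OF n, of \<sigma> x] by simp
    next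
      fix k assume "k \<in> ?K"
      then obtain \<sigma> where k: "k = coding_map \<sigma>" by auto
      have "word_map w \<sigma> n b \<in> ?A n" using b by (auto simp: hutchinson_op_pow)
      from infdist_le[OF this, of k] show "infdist k (?A n) \<le> r / 2"
        using N[OF n, of \<sigma> b] by (simp add: k dist_commute)
    qed auto
    then have "norm (hausdorff_dist (?A n) ?K - 0) < r" if "N \<le> n" for n
      using nonneg[of n] \<open>0 < r\<close> that by force
    then show "\<exists>no. \<forall>n\<ge>no. norm (hausdorff_dist (?A n) ?K - 0) < r" by blast
  qed
qed auto

end

section \<open>Lipschitz functions separate Borel probability measures\<close>

lemma Lip1_imp_continuous_on: "f \<in> Lip1 \<Longrightarrow> continuous_on UNIV f"
  by (auto simp: Lip1_def intro: lipschitz_on_continuous_on)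

lemma Lip1_imp_integrable:
  fixes f :: "'x::metric_space \<Rightarrow> real"
  assumes "bounded (UNIV :: 'x set)" "f \<in> Lip1" "prob_space \<mu>" "sets \<mu> = sets borel"
  shows "integrable \<mu> f"
proof -
  interpret prob_space \<mu> by fact
  have meas: "f \<in> borel_measurable \<mu>"
    using borel_measurable_continuous_onI[OF Lip1_imp_continuous_on[OF assms(2)]]
    by (simp add: measurable_cong_sets[OF assms(4) refl])
  have "norm (f x) \<le> \<bar>f undefined\<bar> + diameter (UNIV :: 'x set)" for x
  proof -
    have "dist (f x) (f undefined) \<le> 1 * dist x undefined"
      using assms(2) by (intro lipschitz_onD[where X = UNIV]) (auto simp: Lip1_def)
    also have "\<dots> \<le> diameter (UNIV :: 'x set)"
      using diameter_bounded_bound[OF assms(1), of x undefined] by simp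
    finally show ?thesis by (simp add: dist_real_def)
  qed
  with meas show ?thesis
    by (intro integrable_const_bound[of _ "\<bar>f undefined\<bar> + diameter (UNIV :: 'x set)"]) auto
qed

lemma min_infdist_Lip1: "(\<lambda>x. min c (infdist x A)) \<in> Lip1"
  unfolding Lip1_def mem_Collect_eq
proof (rule lipschitz_onI)
  fix x y :: 'a
  have "\<bar>min c (infdist x A) - min c (infdist y A)\<bar> \<le> \<bar>infdist x A - infdist y A\<bar>"
    by linarith
  also have "\<dots> \<le> dist x y"
    using infdist_triangle[of x A y] infdist_triangle[of y A x] by (simp add: dist_commute)
  finally show "dist (min c (infdist x A)) (min c (infdist y A)) \<le> 1 * dist x y"
    by (simp add: dist_real_def)
qed simp

text \<open>The open sets are an intersection-stable generator, so it is enough to recover \<open>\<mu> U\<close> for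
  open \<open>U\<close>. The indicator of \<open>U\<close> is the bounded pointwise limit of multiples of the truncated
  distances to the complement.\<close>
lemma prob_measure_eqI_Lip1:
  fixes \<mu> \<nu> :: "'x::metric_space measure"
  assumes "prob_space \<mu>" "sets \<mu> = sets borel" "prob_space \<nu>" "sets \<nu> = sets borel"
    and eq: "\<And>f. f \<in> Lip1 \<Longrightarrow> (\<integral>x. f x \<partial>\<mu>) = (\<integral>x. f x \<partial>\<nu>)"
  shows "\<mu> = \<nu>"
proof (rule measure_eqI_generator_eq[where \<Omega> = UNIV and E = "Collect open" and A = "\<lambda>_. UNIV"])
  interpret \<mu>: prob_space \<mu> by fact
  interpret \<nu>: prob_space \<nu> by fact
  have sp: "space \<mu> = UNIV" "space \<nu> = UNIV"
    using sets_eq_imp_space_eq[OF assms(2)] sets_eq_imp_space_eq[OF assms(4)] by auto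
  fix U :: "'x set" assume "U \<in> Collect open"
  then have U: "open U" by simp
  have "measure \<mu> U = measure \<nu> U"
    \<comment> \<open>\<open>infdist\<close> to the empty set is 0, so the approximation below would fail for \<open>U = UNIV\<close>.\<close>
  proof (cases "U = UNIV")
    case True
    then show ?thesis using \<mu>.prob_space \<nu>.prob_space by (simp add: sp)
  next
    case False
    define g where "g k x = real (Suc k) * min (1 / real (Suc k)) (infdist x (- U))" for k x
    have g_lim: "(\<lambda>k. g k x) \<longlonglongrightarrow> indicator U x" for x
    proof (cases "x \<in> U")
      case False
      then have "infdist x (- U) = 0" by (simp add: infdist_zero)
      with False show ?thesis by (simp add: g_def)
    next
      case True
      have "closed (- U)" using U by (simp add: closed_Compl)
      with True \<open>U \<noteq> UNIV\<close> have pos: "0 < infdist x (- U)"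
        using in_closed_iff_infdist_zero[of "- U" x] infdist_nonneg[of x "- U"] by force
      then obtain n where n: "1 / real (Suc n) < infdist x (- U)"
        using nat_approx_posE by blast
      have "g k x = 1" if "n \<le> k" for k
      proof -
        have "1 / real (Suc k) \<le> 1 / real (Suc n)" using that by (simp add: frac_le)
        with n have "min (1 / real (Suc k)) (infdist x (- U)) = 1 / real (Suc k)" by linarith
        then show ?thesis unfolding g_def by simp
      qed
      then have "\<forall>\<^sub>F k in sequentially. g k x = 1" by (auto simp: eventually_sequentially)
      with True show ?thesis by (simp add: tendsto_eventually)
    qed
    have g_bound: "norm (g k x) \<le> 1" for k x
    proof -
      have "real (Suc k) * min (1 / real (Suc k)) (infdist x (- U)) \<le> real (Suc k) * (1 / real (Suc k))"
        by (intro mult_left_mono) auto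
      moreover have "0 \<le> min (1 / real (Suc k)) (infdist x (- U))" by (simp add: infdist_nonneg)
      ultimately show ?thesis by (simp add: g_def)
    qed
    have conv: "(\<lambda>k. \<integral>x. g k x \<partial>M) \<longlonglongrightarrow> measure M U"
      if "prob_space M" "sets M = sets borel" for M :: "'x measure"
    proof -
      interpret M: prob_space M by fact
      have UM: "U \<in> sets M" using U that(2) by simp
      have "(\<lambda>k. \<integral>x. g k x \<partial>M) \<longlonglongrightarrow> (\<integral>x. indicator U x \<partial>M)"
      proof (rule integral_dominated_convergence[where w = "\<lambda>_. 1"])
        show "g k \<in> borel_measurable M" for k
          unfolding g_def measurable_cong_sets[OF that(2) refl]
          by (intro borel_measurable_continuous_onI continuous_intros)
      qed (use g_lim g_bound UM in auto)
      then show ?thesis using UM by simp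
    qed
    have "(\<integral>x. g k x \<partial>\<mu>) = (\<integral>x. g k x \<partial>\<nu>)" for k
      using eq[OF min_infdist_Lip1[of "1 / real (Suc k)" "- U"]] by (simp add: g_def)
    then show ?thesis
      using conv[OF assms(1,2)] conv[OF assms(3,4)] LIMSEQ_unique by auto
  qed
  then show "emeasure \<mu> U = emeasure \<nu> U"
    by (simp add: \<mu>.emeasure_eq_measure \<nu>.emeasure_eq_measure)
next
  interpret \<mu>: prob_space \<mu> by fact
  show "emeasure \<mu> UNIV \<noteq> \<infinity>" by simp
  show "Int_stable (Collect open :: 'x set set)" by (auto simp: Int_stable_def)
qed (auto simp: assms borel_def)

section \<open>The law of a random orbit\<close>

locale probabilistic_ifs = weakly_hyperbolic_ifs w + sequence_space p
  for w :: "'l::metric_space \<Rightarrow> 'x::metric_space \<Rightarrow> 'x" and p :: "'l measure" +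
  assumes sets_p: "sets p = sets borel"
begin

lemma measurable_ifs: "case_prod w \<in> p \<Otimes>\<^sub>M borel \<rightarrow>\<^sub>M borel"
  using ifs_measurable[OF compact_params compact_space ifs]
  by (subst measurable_cong_sets[OF sets_pair_measure_cong[OF sets_p refl] refl])

text \<open>Joint measurability is derived from the recursion rather than from the joint continuity of
  \<open>word_map\<close>: the product \<open>\<sigma>\<close>-algebra is a priori smaller than the Borel sets of the product,
  as the types do not carry a second-countable topology.\<close>
lemma measurable_word_map: "(\<lambda>(\<sigma>, x). word_map w \<sigma> n x) \<in> S \<Otimes>\<^sub>M borel \<rightarrow>\<^sub>M borel"
proof (induction n)
  case 0
  show ?case by simp
next
  case (Suc n)
  have "(\<lambda>z. (fst z n, snd z)) \<in> S \<Otimes>\<^sub>M borel \<rightarrow>\<^sub>M p \<Otimes>\<^sub>M (borel :: 'x measure)"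
    by measurable
  from measurable_compose[OF this measurable_ifs]
  have "(\<lambda>z. (fst z, w (fst z n) (snd z))) \<in> S \<Otimes>\<^sub>M borel \<rightarrow>\<^sub>M S \<Otimes>\<^sub>M (borel :: 'x measure)"
    by simp
  from measurable_compose[OF this Suc.IH] show ?case
    by (simp add: case_prod_beta)
qed

text \<open>Continuity of the coding map speaks of the Borel sets of the product topology on words; as a pointwise limit it is measurable for the product
  \<open>\<sigma>\<close>-algebra itself.\<close>
lemma measurable_coding_map: "coding_map \<in> S \<rightarrow>\<^sub>M borel"
proof (rule borel_measurable_LIMSEQ_metric)
  show "(\<lambda>\<sigma>. word_map w \<sigma> n undefined) \<in> S \<rightarrow>\<^sub>M borel" for n
    using measurable_compose[OF measurable_Pair2'[of undefined] measurable_word_map[of n]]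
    by simp
qed (rule coding_map_tendsto)

lemma space_p: "space p = UNIV"
  using sets_eq_imp_space_eq[OF sets_p] by simp

lemma space_S: "space S = UNIV"
  by (simp add: space_PiM space_p)

lemma sets_transfer_op: "sets (transfer_op w p \<mu>) = sets borel"
  by (simp add: transfer_op_def sets.sigma_sets_eq[of borel, simplified])

lemma emeasure_transfer_op':
  assumes "prob_space \<mu>" "sets \<mu> = sets borel" "B \<in> sets borel"
  shows "emeasure (transfer_op w p \<mu>) B = (\<integral>\<^sup>+ l. emeasure \<mu> (w l -` B) \<partial>p)"
  using emeasure_transfer_op[OF compact_params compact_space ifs prob_space sets_p assms] .

lemma prob_space_transfer_op:
  assumes "prob_space \<mu>" "sets \<mu> = sets borel"
  shows "prob_space (transfer_op w p \<mu>)"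
proof (rule prob_spaceI)
  interpret \<mu>: prob_space \<mu> by fact
  have "space \<mu> = UNIV" using sets_eq_imp_space_eq[OF assms(2)] by simp
  moreover have "space (transfer_op w p \<mu>) = UNIV"
    using sets_eq_imp_space_eq[OF sets_transfer_op] by simp
  ultimately show "emeasure (transfer_op w p \<mu>) (space (transfer_op w p \<mu>)) = 1"
    using emeasure_transfer_op'[OF assms, of UNIV] \<mu>.emeasure_space_1 by (simp add: M.emeasure_space_1)
qed

text \<open>Prepending an independent letter of law \<open>p\<close> to a random word gives a word with the same
  law.\<close>
lemma nn_integral_S_case_nat:
  assumes "h \<in> borel_measurable S"
  shows "(\<integral>\<^sup>+ l. \<integral>\<^sup>+ \<sigma>. h (case_nat l \<sigma>) \<partial>S \<partial>p) = (\<integral>\<^sup>+ \<sigma>. h \<sigma> \<partial>S)"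
proof -
  have m: "(\<lambda>(l, \<sigma>). case_nat l \<sigma>) \<in> p \<Otimes>\<^sub>M S \<rightarrow>\<^sub>M S" by measurable
  have "(\<integral>\<^sup>+ \<sigma>. h \<sigma> \<partial>S) = (\<integral>\<^sup>+ z. h (case z of (l, \<sigma>) \<Rightarrow> case_nat l \<sigma>) \<partial>(p \<Otimes>\<^sub>M S))"
    using nn_integral_distr[OF m, of h] assms unfolding PiM_iter by simp
  also have "\<dots> = (\<integral>\<^sup>+ l. \<integral>\<^sup>+ \<sigma>. h (case_nat l \<sigma>) \<partial>S \<partial>p)"
    using P.nn_integral_fst[OF measurable_compose[OF m assms], symmetric] by simp
  finally show ?thesis by simp
qed

text \<open>Applying the transfer operator once more prepends an independent letter to the random word,
  which does not change the law of the word. The induction runs on the values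
  \<open>\<integral>\<^sup>+ \<sigma>. emeasure \<mu> (word_map w \<sigma> n -` B) \<partial>S\<close>, to avoid reassociating threefold product
  measures, and carries along that every iterate is a Borel probability measure, so that the
  formula for the transfer operator applies to it.\<close>
lemma transfer_op_pow:
  assumes "prob_space \<mu>" "sets \<mu> = sets borel"
  shows "(transfer_op w p ^^ n) \<mu> = distr (S \<Otimes>\<^sub>M \<mu>) borel (\<lambda>(\<sigma>, x). word_map w \<sigma> n x)"
proof -
  interpret \<mu>: prob_space \<mu> by fact
  have space_\<mu>: "space \<mu> = UNIV" using sets_eq_imp_space_eq[OF assms(2)] by simp
  have W: "(\<lambda>(\<sigma>, x). word_map w \<sigma> n x) \<in> S \<Otimes>\<^sub>M \<mu> \<rightarrow>\<^sub>M borel" for n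
    using measurable_word_map[of n]
    by (subst measurable_cong_sets[OF sets_pair_measure_cong[OF refl assms(2)] refl])
  have vimage: "(\<lambda>(\<sigma>, x). word_map w \<sigma> n x) -` B \<in> sets (S \<Otimes>\<^sub>M \<mu>)" if "B \<in> sets borel" for n B
    using measurable_sets[OF W that, of n] by (simp add: space_pair_measure space_S space_\<mu>)
  have Pair_vimage: "Pair \<sigma> -` (\<lambda>(\<sigma>, x). word_map w \<sigma> n x) -` B = word_map w \<sigma> n -` B" for \<sigma> n B
    by auto
  have meas: "(\<lambda>\<sigma>. emeasure \<mu> (word_map w \<sigma> n -` B)) \<in> borel_measurable S"
    if "B \<in> sets borel" for n B
    using \<mu>.measurable_emeasure_Pair[OF vimage[OF that, of n]] by (simp add: Pair_vimage)
  have *: "prob_space ((transfer_op w p ^^ n) \<mu>) \<and> sets ((transfer_op w p ^^ n) \<mu>) = sets borel \<and>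
    (\<forall>B\<in>sets borel. emeasure ((transfer_op w p ^^ n) \<mu>) B = (\<integral>\<^sup>+ \<sigma>. emeasure \<mu> (word_map w \<sigma> n -` B) \<partial>S))" for n
  proof (induction n)
    case 0
    show ?case using assms by (simp add: emeasure_space_1)
  next
    case (Suc n)
    let ?M = "(transfer_op w p ^^ n) \<mu>"
    have M: "prob_space ?M" "sets ?M = sets borel" using Suc.IH by auto
    have "emeasure (transfer_op w p ?M) B = (\<integral>\<^sup>+ \<sigma>. emeasure \<mu> (word_map w \<sigma> (Suc n) -` B) \<partial>S)"
      if B: "B \<in> sets borel" for B
    proof -
      have vim: "w l -` B \<in> sets borel" for l
        using measurable_sets[OF measurable_compose[OF measurable_Pair1' measurable_ifs], of l B] B
        by (simp add: space_p)
      have "emeasure (transfer_op w p ?M) B = (\<integral>\<^sup>+ l. emeasure ?M (w l -` B) \<partial>p)"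
        by (rule emeasure_transfer_op'[OF M B])
      also have "\<dots> = (\<integral>\<^sup>+ l. \<integral>\<^sup>+ \<sigma>. emeasure \<mu> (word_map w \<sigma> n -` w l -` B) \<partial>S \<partial>p)"
        using Suc.IH vim by simp
      also have "\<dots> = (\<integral>\<^sup>+ l. \<integral>\<^sup>+ \<sigma>. emeasure \<mu> (word_map w (case_nat l \<sigma>) (Suc n) -` B) \<partial>S \<partial>p)"
        unfolding word_map_case_nat by (simp add: vimage_comp)
      also have "\<dots> = (\<integral>\<^sup>+ \<sigma>. emeasure \<mu> (word_map w \<sigma> (Suc n) -` B) \<partial>S)"
        by (rule nn_integral_S_case_nat[OF meas[OF B]])
      finally show ?thesis .
    qed
    then show ?case
      using prob_space_transfer_op[OF M] by (simp add: sets_transfer_op del: word_map.simps)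
  qed
  show ?thesis
  proof (rule measure_eqI)
    fix B assume "B \<in> sets ((transfer_op w p ^^ n) \<mu>)"
    then have B: "B \<in> sets borel" using * by simp
    show "emeasure ((transfer_op w p ^^ n) \<mu>) B = emeasure (distr (S \<Otimes>\<^sub>M \<mu>) borel (\<lambda>(\<sigma>, x). word_map w \<sigma> n x)) B"
      using * B emeasure_distr[OF W B, of n] \<mu>.emeasure_pair_measure_alt[OF vimage[OF B, of n]]
      by (simp add: space_pair_measure space_S space_\<mu> Pair_vimage)
  qed (use * in simp)
qed

section \<open>The invariant measure\<close>

definition coding_measure :: "'x measure" where
  "coding_measure = distr S borel coding_map"

lemma sets_coding_measure [simp]: "sets coding_measure = sets borel"
  by (simp add: coding_measure_def)

lemma prob_space_coding_measure: "prob_space coding_measure"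
  unfolding coding_measure_def
  by (rule P.prob_space_distr[OF measurable_coding_map])

lemma lip_prob_measures_iff:
  "\<mu> \<in> lip_prob_measures \<longleftrightarrow> prob_space \<mu> \<and> sets \<mu> = sets (borel :: 'x measure)"
  by (auto simp: lip_prob_measures_def intro: Lip1_imp_integrable[OF bounded_space])

lemma emeasure_coding_measure:
  assumes "B \<in> sets borel"
  shows "emeasure coding_measure B = emeasure S (coding_map -` B)"
  using emeasure_distr[OF measurable_coding_map assms] by (simp add: coding_measure_def space_S)

lemma transfer_op_coding_measure: "transfer_op w p coding_measure = coding_measure"
proof (rule measure_eqI)
  fix B assume "B \<in> sets (transfer_op w p coding_measure)"
  then have B: "B \<in> sets borel" by (simp add: sets_transfer_op)
  have vim: "w l -` B \<in> sets borel" for l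
    using measurable_sets[OF measurable_compose[OF measurable_Pair1' measurable_ifs], of l B] B
    by (simp add: space_p)
  have cod: "coding_map -` A \<in> sets S" if "A \<in> sets borel" for A
    using measurable_sets[OF measurable_coding_map that] by (simp add: space_S)
  have "emeasure (transfer_op w p coding_measure) B = (\<integral>\<^sup>+ l. emeasure S (coding_map -` w l -` B) \<partial>p)"
    by (simp add: emeasure_transfer_op'[OF prob_space_coding_measure _ B] emeasure_coding_measure vim)
  also have "\<dots> = (\<integral>\<^sup>+ l. \<integral>\<^sup>+ \<sigma>. indicator (coding_map -` w l -` B) \<sigma> \<partial>S \<partial>p)"
    by (simp add: cod vim)
  also have "\<dots> = (\<integral>\<^sup>+ l. \<integral>\<^sup>+ \<sigma>. indicator (coding_map -` B) (case_nat l \<sigma>) \<partial>S \<partial>p)"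
    by (simp add: indicator_def coding_map_case_nat)
  also have "\<dots> = (\<integral>\<^sup>+ \<sigma>. indicator (coding_map -` B) \<sigma> \<partial>S)"
    by (rule nn_integral_S_case_nat[OF borel_measurable_indicator[OF cod[OF B]]])
  also have "\<dots> = emeasure coding_measure B"
    by (simp add: cod B emeasure_coding_measure)
  finally show "emeasure (transfer_op w p coding_measure) B = emeasure coding_measure B" .
qed (simp add: sets_transfer_op)

text \<open>A coupling argument: \<open>(\<sigma>, x) \<mapsto> word_map w \<sigma> n x\<close> and \<open>(\<sigma>, x) \<mapsto> coding_map \<sigma>\<close> realise the
  two measures on the same product space and differ by at most \<open>\<epsilon>\<close> everywhere. The resulting
  index \<open>N\<close> works for all \<open>\<mu>\<close> and all 1-Lipschitz \<open>f\<close> at once.\<close>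
lemma uniform_integral_convergence:
  assumes "0 < \<epsilon>"
  obtains N where "\<And>\<mu> n f. \<mu> \<in> lip_prob_measures \<Longrightarrow> N \<le> n \<Longrightarrow> f \<in> Lip1 \<Longrightarrow>
    \<bar>(\<integral>x. f x \<partial>((transfer_op w p ^^ n) \<mu>)) - (\<integral>x. f x \<partial>coding_measure)\<bar> \<le> \<epsilon>"
proof -
  obtain N where N: "\<And>\<sigma> n x. N \<le> n \<Longrightarrow> dist (word_map w \<sigma> n x) (coding_map \<sigma>) < \<epsilon>"
    by (rule coding_map_uniform[OF assms]) blast
  show thesis
  proof (rule that)
    fix \<mu> :: "'x measure" and n and f :: "'x \<Rightarrow> real"
    assume \<mu>: "\<mu> \<in> lip_prob_measures" and n: "N \<le> n" and f: "f \<in> Lip1"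
    then have \<mu>': "prob_space \<mu>" "sets \<mu> = sets borel" by (auto simp: lip_prob_measures_iff)
    interpret \<mu>: prob_space \<mu> by fact
    interpret S\<mu>: pair_prob_space S \<mu> ..
    have W: "(\<lambda>(\<sigma>, x). word_map w \<sigma> n x) \<in> S \<Otimes>\<^sub>M \<mu> \<rightarrow>\<^sub>M borel"
      using measurable_word_map[of n]
      by (subst measurable_cong_sets[OF sets_pair_measure_cong[OF refl \<mu>'(2)] refl])
    have C: "(\<lambda>z. coding_map (fst z)) \<in> S \<Otimes>\<^sub>M \<mu> \<rightarrow>\<^sub>M borel"
      by (rule measurable_compose[OF measurable_fst measurable_coding_map])
    have fm: "f \<in> borel_measurable borel"
      by (rule borel_measurable_continuous_onI[OF Lip1_imp_continuous_on[OF f]])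
    have int: "integrable (S \<Otimes>\<^sub>M \<mu>) (\<lambda>z. f (g z))" if g: "g \<in> S \<Otimes>\<^sub>M \<mu> \<rightarrow>\<^sub>M borel" for g
    proof -
      have "integrable (distr (S \<Otimes>\<^sub>M \<mu>) borel g) f"
        using Lip1_imp_integrable[OF bounded_space f S\<mu>.prob_space_distr[OF g]] by simp
      then show ?thesis using integrable_distr_eq[OF g fm] by simp
    qed
    have 1: "(\<integral>x. f x \<partial>((transfer_op w p ^^ n) \<mu>)) = (\<integral>z. f (word_map w (fst z) n (snd z)) \<partial>(S \<Otimes>\<^sub>M \<mu>))"
      unfolding transfer_op_pow[OF \<mu>']
      by (subst integral_distr[OF W fm]) (simp add: case_prod_beta)
    have 2: "(\<integral>x. f x \<partial>coding_measure) = (\<integral>z. f (coding_map (fst z)) \<partial>(S \<Otimes>\<^sub>M \<mu>))"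
    proof -
      have "(\<integral>z. f (coding_map (fst z)) \<partial>(S \<Otimes>\<^sub>M \<mu>)) = (\<integral>\<sigma>. f (coding_map \<sigma>) \<partial>(distr (S \<Otimes>\<^sub>M \<mu>) S fst))"
        by (rule integral_distr[symmetric])
          (auto intro: measurable_compose[OF measurable_coding_map fm])
      also have "distr (S \<Otimes>\<^sub>M \<mu>) S fst = S"
        by (rule \<mu>.distr_pair_fst)
      finally show ?thesis
        unfolding coding_measure_def by (simp add: integral_distr[OF measurable_coding_map fm])
    qed
    have pw: "\<bar>f (word_map w \<sigma> n x) - f (coding_map \<sigma>)\<bar> \<le> \<epsilon>" for \<sigma> x
    proof -
      have "dist (f (word_map w \<sigma> n x)) (f (coding_map \<sigma>)) \<le> 1 * dist (word_map w \<sigma> n x) (coding_map \<sigma>)"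
        using f by (intro lipschitz_onD[where X = UNIV]) (auto simp: Lip1_def)
      then show ?thesis using N[OF n, of \<sigma> x] by (simp add: dist_real_def)
    qed
    have i1: "integrable (S \<Otimes>\<^sub>M \<mu>) (\<lambda>z. f (word_map w (fst z) n (snd z)))"
      using int[OF W] by (simp add: case_prod_beta)
    note i2 = int[OF C]
    let ?d = "\<lambda>z. f (word_map w (fst z) n (snd z)) - f (coding_map (fst z))"
    have "\<bar>\<integral>z. ?d z \<partial>(S \<Otimes>\<^sub>M \<mu>)\<bar> \<le> (\<integral>z. \<bar>?d z\<bar> \<partial>(S \<Otimes>\<^sub>M \<mu>))"
      by (rule integral_abs_bound)
    also have "\<dots> \<le> (\<integral>z. \<epsilon> \<partial>(S \<Otimes>\<^sub>M \<mu>))"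
      using i1 i2 pw by (intro integral_mono) auto
    also have "\<dots> = \<epsilon>" by (simp add: S\<mu>.prob_space)
    finally show "\<bar>(\<integral>x. f x \<partial>((transfer_op w p ^^ n) \<mu>)) - (\<integral>x. f x \<partial>coding_measure)\<bar> \<le> \<epsilon>"
      using i1 i2 unfolding 1 2 by simp
  qed
qed

lemma measure_attractor_coding_measure: "measure_attractor w p coding_measure"
  unfolding measure_attractor_def
proof (intro conjI ballI)
  show "coding_measure \<in> lip_prob_measures"
    by (simp add: lip_prob_measures_iff prob_space_coding_measure)
  fix \<mu> :: "'x measure" assume \<mu>: "\<mu> \<in> lip_prob_measures"
  show "(\<lambda>n. hutchinson_dist ((transfer_op w p ^^ n) \<mu>) coding_measure) \<longlonglongrightarrow> 0"
  proof (rule LIMSEQ_I)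
    fix r :: real assume "0 < r"
    from half_gt_zero[OF this] obtain N where N: "\<And>\<mu> n f. \<mu> \<in> lip_prob_measures \<Longrightarrow> N \<le> n \<Longrightarrow> f \<in> Lip1 \<Longrightarrow>
      \<bar>(\<integral>x. f x \<partial>((transfer_op w p ^^ n) \<mu>)) - (\<integral>x. f x \<partial>coding_measure)\<bar> \<le> r / 2"
      by (rule uniform_integral_convergence) blast
    have zero: "(\<lambda>_. 0) \<in> (Lip1 :: ('x \<Rightarrow> real) set)"
      by (auto simp: Lip1_def intro: lipschitz_onI)
    have "hutchinson_dist ((transfer_op w p ^^ n) \<mu>) coding_measure \<in> {0..r / 2}" if n: "N \<le> n" for n
    proof -
      let ?h = "\<lambda>f. \<bar>(\<integral>x. f x \<partial>((transfer_op w p ^^ n) \<mu>)) - (\<integral>x. f x \<partial>coding_measure)\<bar>"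
      have "(SUP f\<in>Lip1. ?h f) \<le> r / 2"
        using zero by (intro cSUP_least N[OF \<mu> n]) auto
      moreover have "?h (\<lambda>_. 0) \<le> (SUP f\<in>Lip1. ?h f)"
        by (intro cSUP_upper zero bdd_aboveI2[of _ _ "r / 2"] N[OF \<mu> n])
      ultimately show ?thesis by (simp add: hutchinson_dist_def)
    qed
    then have "norm (hutchinson_dist ((transfer_op w p ^^ n) \<mu>) coding_measure - 0) < r" if "N \<le> n" for n
      using \<open>0 < r\<close> that by force
    then show "\<exists>no. \<forall>n\<ge>no. norm (hutchinson_dist ((transfer_op w p ^^ n) \<mu>) coding_measure - 0) < r"
      by blast
  qed
qed

lemma transfer_op_fixpoint_unique:
  assumes \<mu>: "\<mu> \<in> lip_prob_measures" and fixpoint: "transfer_op w p \<mu> = \<mu>"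
  shows "\<mu> = coding_measure"
proof (rule prob_measure_eqI_Lip1)
  fix f :: "'x \<Rightarrow> real" assume f: "f \<in> Lip1"
  have pow: "(transfer_op w p ^^ n) \<mu> = \<mu>" for n by (induction n) (simp_all add: fixpoint)
  have "\<bar>(\<integral>x. f x \<partial>\<mu>) - (\<integral>x. f x \<partial>coding_measure)\<bar> \<le> \<epsilon>" if \<epsilon>: "0 < \<epsilon>" for \<epsilon>
  proof -
    obtain N where "\<And>\<mu> n f. \<mu> \<in> lip_prob_measures \<Longrightarrow> N \<le> n \<Longrightarrow> f \<in> Lip1 \<Longrightarrow>
      \<bar>(\<integral>x. f x \<partial>((transfer_op w p ^^ n) \<mu>)) - (\<integral>x. f x \<partial>coding_measure)\<bar> \<le> \<epsilon>"
      by (rule uniform_integral_convergence[OF \<epsilon>]) blast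
    from this[OF \<mu> order_refl f] show ?thesis by (simp add: pow)
  qed
  then have "\<bar>(\<integral>x. f x \<partial>\<mu>) - (\<integral>x. f x \<partial>coding_measure)\<bar> \<le> 0"
    by (rule field_le_epsilon) simp
  then show "(\<integral>x. f x \<partial>\<mu>) = (\<integral>x. f x \<partial>coding_measure)" by simp
qed (use \<mu> prob_space_coding_measure in \<open>auto simp: lip_prob_measures_iff\<close>)

section \<open>The support\<close>

text \<open>An open set of words contains a cylinder around each of its points, which restricts finitely
  many letters to nonempty open sets; the measure of the cylinder is the product of their positive
  measures.\<close>
lemma measure_S_open_pos:
  assumes full: "\<And>U. open U \<Longrightarrow> U \<noteq> {} \<Longrightarrow> 0 < measure p U"
    and V: "open V" "\<sigma> \<in> V" "V \<in> sets S"
  shows "0 < measure S V"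
proof -
  have "openin (product_topology (\<lambda>_. euclidean) UNIV) V" using V(1) by (simp add: open_fun_def)
  from product_topology_open_contains_basis[OF this V(2)]
  obtain X where X: "\<And>i. \<sigma> i \<in> X i" "\<And>i. open (X i)" "finite {i. X i \<noteq> UNIV}" "Pi\<^sub>E UNIV X \<subseteq> V"
    by (auto simp: PiE_iff)
  define J where "J = {i. X i \<noteq> UNIV}"
  have "0 < (\<Prod>i\<in>J. measure p (X i))"
    using X(1,2) by (intro prod_pos full) auto
  also have "\<dots> = measure S (emb UNIV J (Pi\<^sub>E J X))"
    using X(2,3) by (intro measure_PiM_emb[symmetric]) (auto simp: J_def sets_p)
  also have "\<dots> \<le> measure S V"
  proof (rule P.finite_measure_mono[OF _ V(3)])
    show "emb UNIV J (Pi\<^sub>E J X) \<subseteq> V"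
      using X(4) by (fastforce simp: prod_emb_def PiE_iff J_def)
  qed
  finally show ?thesis .
qed

lemma measure_support_coding_measure:
  assumes full: "\<And>U. open U \<Longrightarrow> U \<noteq> {} \<Longrightarrow> 0 < measure p U"
  shows "measure_support coding_measure = range coding_map"
proof -
  have meas: "measure coding_measure U = measure S (coding_map -` U)" if "open U" for U
    using emeasure_coding_measure[of U] that by (simp add: measure_def)
  show ?thesis
  proof (intro equalityI subsetI)
    fix x assume x: "x \<in> measure_support coding_measure"
    have "open (- range coding_map)"
      using compact_imp_closed[OF compact_range_coding_map] by (simp add: open_Compl)
    moreover have "coding_map -` (- range coding_map) = {}" by auto
    ultimately have "measure coding_measure (- range coding_map) = 0" by (simp add: meas)
    with x \<open>open (- range coding_map)\<close> show "x \<in> range coding_map"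
      by (force simp: measure_support_def)
  next
    fix x assume "x \<in> range coding_map"
    then obtain \<sigma> where \<sigma>: "x = coding_map \<sigma>" by auto
    show "x \<in> measure_support coding_measure"
      unfolding measure_support_def
    proof (intro CollectI allI impI)
      fix U assume U: "open U \<and> x \<in> U"
      have "0 < measure S (coding_map -` U)"
      proof (rule measure_S_open_pos[OF full])
        show "open (coding_map -` U)"
          using U continuous_on_coding_map by (simp add: open_vimage)
        show "\<sigma> \<in> coding_map -` U" using U \<sigma> by simp
        show "coding_map -` U \<in> sets S"
          using measurable_sets[OF measurable_coding_map, of U] U by (simp add: space_S)
      qed
      then show "0 < measure coding_measure U" using U by (simp add: meas)
    qed
  qed
qed

end

theorem theorem2:
  fixes w :: "'l::metric_space \<Rightarrow> 'x::metric_space \<Rightarrow> 'x"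
    and p :: "'l measure"
  assumes "compact (UNIV :: 'l set)"
    and "compact (UNIV :: 'x set)"
    and "ifs w"
    and "weakly_hyperbolic w"
    and "prob_space p" and "sets p = sets borel"
  shows "\<exists>\<nu>. measure_attractor w p \<nu>
    \<and> transfer_op w p \<nu> = \<nu>
    \<and> (\<forall>\<mu>\<in>lip_prob_measures. transfer_op w p \<mu> = \<mu> \<longrightarrow> \<mu> = \<nu>)
    \<and> ((\<forall>U. open U \<and> U \<noteq> {} \<longrightarrow> measure p U > 0) \<longrightarrow>
         (\<exists>K. topological_attractor w K \<and> measure_support \<nu> = K))"
proof -
  interpret prob_space p by fact
  interpret probabilistic_ifs w p
    by unfold_locales (use assms in auto)
  show ?thesis
    using measure_attractor_coding_measure transfer_op_coding_measure transfer_op_fixpoint_unique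
      topological_attractor_range_coding_map measure_support_coding_measure
    by (intro exI[of _ coding_measure]) auto
qed

end
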